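(* A $1$-dimensional simplicial complex $\Delta$ is convex union representable if and only if it is collapsible (in particular, if and only if it is a tree).
   Context: A simplicial complex on a finite ground set is a collection $\Delta$ of subsets (faces) closed under inclusion. Facets are inclusion-maximal faces; $\dim\sigma=|\sigma|-1$. A $1$-dimensional complex is a graph with at least one edge. The deletion is $\Delta\setminus\sigma=\{\tau\in\Delta\mid\tau\not\supseteq\sigma\}$. A face $\sigma$ that is not a facet is free if it is contained in a unique facet; then $\Delta\to\Delta\setminus\sigma$ is an elementary collapse (the empty face may be used). $\Delta$ is collapsible if some finite sequence of elementary collapses leads from $\Delta$ to the void complex $\emptyset$ having no faces (for a complex with at least one vertex: equivalently, to a single vertex). For a collection $\mathcal U=\{U_1,\dots,U_n\}$ of convex subsets of $\mathbb R^d$ (the empty set is convex and open), put $U_\sigma=\bigcap_{i\in\sigma}U_i$ for $\emptyset\ne\sigma\subseteq[n]$ and $U_\emptyset=\operatorname{conv}(\bigcup_i U_i)$. The nerve is $\mathcal N(\mathcal U)=\{\sigma\subseteq[n]\mid U_\sigma\neq\emptyset\}$. A complex $\Delta\subseteq 2^{[n]}$ is convex union representable if for some integer $d\ge0$, $\Delta=\mathcal N(\mathcal U)$ for some collection $\mathcal U=\{U_i\}_{i=1}^n$ of convex open sets in $\mathbb R^d$ whose union is convex. *)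

theory Defs
  imports "HOL-Analysis.Analysis" "HOL-Analysis.Finite_Function_Topology"
begin

section \<open>Finite abstract simplicial complexes\<close>

definition abstract_simplicial_complex :: "'a set \<Rightarrow> 'a set set \<Rightarrow> bool" where
  "abstract_simplicial_complex V \<Delta> \<longleftrightarrow>
     finite V \<and> \<Delta> \<subseteq> Pow V \<and> (\<forall>\<sigma>\<in>\<Delta>. \<forall>\<tau>. \<tau> \<subseteq> \<sigma> \<longrightarrow> \<tau> \<in> \<Delta>)"

definition face_dim :: "'a set \<Rightarrow> int" where
  "face_dim \<sigma> = int (card \<sigma>) - 1"

text \<open>A predicate rather than a maximum, so that the void complex has no dimension.\<close>

definition has_dimension :: "'a set set \<Rightarrow> int \<Rightarrow> bool" where
  "has_dimension \<Delta> k \<longleftrightarrow> (\<exists>\<sigma>\<in>\<Delta>. face_dim \<sigma> = k) \<and> (\<forall>\<sigma>\<in>\<Delta>. face_dim \<sigma> \<le> k)"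

definition facet :: "'a set set \<Rightarrow> 'a set \<Rightarrow> bool" where
  "facet \<Delta> \<sigma> \<longleftrightarrow> \<sigma> \<in> \<Delta> \<and> (\<forall>\<tau>\<in>\<Delta>. \<sigma> \<subseteq> \<tau> \<longrightarrow> \<tau> = \<sigma>)"

definition deletion :: "'a set set \<Rightarrow> 'a set \<Rightarrow> 'a set set" where
  "deletion \<Delta> \<sigma> = {\<tau> \<in> \<Delta>. \<not> \<sigma> \<subseteq> \<tau>}"

definition free_face :: "'a set set \<Rightarrow> 'a set \<Rightarrow> bool" where
  "free_face \<Delta> \<sigma> \<longleftrightarrow> \<sigma> \<in> \<Delta> \<and> \<not> facet \<Delta> \<sigma> \<and> (\<exists>!\<phi>. facet \<Delta> \<phi> \<and> \<sigma> \<subseteq> \<phi>)"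

definition elementary_collapse :: "'a set set \<Rightarrow> 'a set set \<Rightarrow> bool" where
  "elementary_collapse \<Delta> \<Gamma> \<longleftrightarrow> (\<exists>\<sigma>. free_face \<Delta> \<sigma> \<and> \<Gamma> = deletion \<Delta> \<sigma>)"

text \<open>The target is the void complex, which lacks even the empty face; the final
  collapse removes a simplex together with its free face \<open>{}\<close>.\<close>

definition collapsible :: "'a set set \<Rightarrow> bool" where
  "collapsible \<Delta> \<longleftrightarrow> elementary_collapse\<^sup>*\<^sup>* \<Delta> {}"

section \<open>Trees\<close>

text \<open>A complex of dimension at most one is read as the graph of its singleton and two-element
  faces. Isolated vertices count as vertices of the graph, elements of the ground set that
  are not faces do not.\<close>

definition complex_vertices :: "'a set set \<Rightarrow> 'a set" where
  "complex_vertices \<Delta> = {v. {v} \<in> \<Delta>}"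

definition complex_adj :: "'a set set \<Rightarrow> 'a \<Rightarrow> 'a \<Rightarrow> bool" where
  "complex_adj \<Delta> u v \<longleftrightarrow> u \<noteq> v \<and> {u, v} \<in> \<Delta>"

definition graph_connected :: "'a set set \<Rightarrow> bool" where
  "graph_connected \<Delta> \<longleftrightarrow> complex_vertices \<Delta> \<noteq> {} \<and>
     (\<forall>u\<in>complex_vertices \<Delta>. \<forall>v\<in>complex_vertices \<Delta>. (complex_adj \<Delta>)\<^sup>*\<^sup>* u v)"

definition graph_cycle :: "'a set set \<Rightarrow> 'a list \<Rightarrow> bool" where
  "graph_cycle \<Delta> p \<longleftrightarrow> 3 \<le> length p \<and> distinct p \<and>
     (\<forall>i<length p. complex_adj \<Delta> (p ! i) (p ! (Suc i mod length p)))"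

definition graph_tree :: "'a set set \<Rightarrow> bool" where
  "graph_tree \<Delta> \<longleftrightarrow> graph_connected \<Delta> \<and> (\<nexists>p. graph_cycle \<Delta> p)"

section \<open>Convex union representability\<close>

text \<open>Since the dimension \<open>d\<close> is quantified inside the definition below, it cannot be a
  type index. We model \<open>\<real>\<^sup>d\<close> as the subspace of finitely supported sequences whose
  support lies in \<open>{..<d}\<close>. On this finite-dimensional subspace the norm topology
  inherited from the ambient normed space is the usual one.\<close>

definition coord_space :: "nat \<Rightarrow> (nat \<Rightarrow>\<^sub>0 real) set" where
  "coord_space d = {x. Poly_Mapping.keys x \<subseteq> {..<d}}"

definition nerve_inter :: "'a set \<Rightarrow> ('a \<Rightarrow> 'v::real_vector set) \<Rightarrow> 'a set \<Rightarrow> 'v set" where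
  "nerve_inter V U \<sigma> = (if \<sigma> = {} then convex hull (\<Union>i\<in>V. U i) else (\<Inter>i\<in>\<sigma>. U i))"

definition nerve :: "'a set \<Rightarrow> ('a \<Rightarrow> 'v::real_vector set) \<Rightarrow> 'a set set" where
  "nerve V U = {\<sigma>. \<sigma> \<subseteq> V \<and> nerve_inter V U \<sigma> \<noteq> {}}"

definition convex_union_representable :: "'a set \<Rightarrow> 'a set set \<Rightarrow> bool" where
  "convex_union_representable V \<Delta> \<longleftrightarrow>
     (\<exists>d. \<exists>U :: 'a \<Rightarrow> (nat \<Rightarrow>\<^sub>0 real) set.
        (\<forall>i\<in>V. openin (top_of_set (coord_space d)) (U i) \<and> convex (U i)) \<and>
        convex (\<Union>i\<in>V. U i) \<and>
        \<Delta> = nerve V U)"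

end

theory Submission
  imports Defs
begin

text \<open>For complexes of dimension one, the three properties in question all agree with a fourth
  one, that the complex can be grown from a vertex by attaching leaves (\<open>leaf_built\<close>).
  A collapse of a graph removes a leaf, so collapsible complexes and complexes grown by leaves
  are the same (\<open>leaf_built_collapsible\<close>, \<open>collapsible_leaf_built\<close>); and a finite tree has a leaf
  whose removal leaves a tree (\<open>graph_tree_leaf_built\<close>).

  A convex union representable graph is a tree. It is connected because the union of the sets is
  connected. Suppose it had a cycle, and let \<open>ab\<close> be one of its edges. No three of the
  sets have a common point, so there is a continuous map from the union to the circle that winds
  around once on the way from \<open>U\<^sub>a\<close> to \<open>U\<^sub>b\<close> and is constant on all other sets. A
  loop that follows the cycle has winding number one under this map, whereas the union is convex, so
  that the map has a continuous logarithm and all winding numbers vanish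
  (\<open>convex_union_no_cycle\<close>).

  Conversely, a complex grown by leaves is represented by an explicit family of open polyhedra
  (\<open>leaf_built_representable\<close>). Give the graph with \<open>n\<close> vertices one coordinate for each vertex,
  to be thought of as the amount of mass in the branch above it. Suitable linear inequalities cut
  out a convex body in which the heavy vertices form a chain from the root. The cell of a
  vertex \<open>k\<close> consists of the points where \<open>k\<close> is heavy while its children are not too heavy, the thresholds
  growing with the number of the vertex. The cells cover the body, and two of them meet
  exactly when one vertex is the parent of the other.\<close>

section \<open>Graphs grown by attaching leaves\<close>

definition graph_like :: "'a set set \<Rightarrow> bool" where
  "graph_like \<Delta> \<longleftrightarrow> (\<forall>\<sigma>\<in>\<Delta>. Pow \<sigma> \<subseteq> \<Delta>) \<and> (\<forall>\<sigma>\<in>\<Delta>. finite \<sigma> \<and> card \<sigma> \<le> 2)"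

text \<open>The common normal form of collapsible complexes and trees: its steps are the reversed collapses, it peels a tree
  leaf by leaf, and it lists the vertices in an order suited to the geometric construction.\<close>

inductive leaf_built :: "'a set set \<Rightarrow> bool" where
  vertex: "leaf_built {{}, {v}}"
| leaf: "leaf_built (insert {v} (insert {v, w} \<Gamma>))" if "leaf_built \<Gamma>" "{w} \<in> \<Gamma>" "{v} \<notin> \<Gamma>"

lemma graph_like_subset: "graph_like \<Delta> \<Longrightarrow> \<sigma> \<in> \<Delta> \<Longrightarrow> \<tau> \<subseteq> \<sigma> \<Longrightarrow> \<tau> \<in> \<Delta>"
  unfolding graph_like_def by blast

lemma graph_like_deletion: "graph_like \<Delta> \<Longrightarrow> graph_like (deletion \<Delta> \<sigma>)"
  by (auto simp: graph_like_def deletion_def)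

lemma graph_like_faceE:
  assumes "graph_like \<Delta>" "\<sigma> \<in> \<Delta>"
  obtains "\<sigma> = {}" | v where "\<sigma> = {v}" | v w where "v \<noteq> w" "\<sigma> = {v, w}"
proof -
  have "finite \<sigma>" "card \<sigma> \<le> 2" using assms by (auto simp: graph_like_def)
  then consider "card \<sigma> = 0" | "card \<sigma> = 1" | "card \<sigma> = 2" by linarith
  then show thesis
    using that \<open>finite \<sigma>\<close> by cases (auto simp: card_1_singleton_iff card_2_iff)
qed

lemma graph_like_edge_facet:
  assumes "graph_like \<Delta>" "{v, w} \<in> \<Delta>" "v \<noteq> w"
  shows "facet \<Delta> {v, w}"
  unfolding facet_def
proof (intro conjI ballI impI)
  fix \<tau> assume \<tau>: "\<tau> \<in> \<Delta>" "{v, w} \<subseteq> \<tau>"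
  with assms have "finite \<tau>" "card \<tau> \<le> card {v, w}" by (auto simp: graph_like_def)
  with \<tau> show "\<tau> = {v, w}" by (metis card_seteq)
qed (use assms in auto)

lemma leaf_built_graph_like: "leaf_built \<Delta> \<Longrightarrow> graph_like \<Delta>"
proof (induction rule: leaf_built.induct)
  case (vertex v)
  then show ?case by (auto simp: graph_like_def)
next
  case (leaf \<Gamma> w v)
  have ne: "v \<noteq> w" using leaf by auto
  have e: "{} \<in> \<Gamma>" using leaf by (blast intro: graph_like_subset)
  show ?case unfolding graph_like_def
  proof (intro conjI ballI)
    fix \<sigma> assume "\<sigma> \<in> insert {v} (insert {v, w} \<Gamma>)"
    then consider "\<sigma> = {v}" | "\<sigma> = {v, w}" | "\<sigma> \<in> \<Gamma>" by blast
    note \<sigma> = this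
    from \<sigma> show "Pow \<sigma> \<subseteq> insert {v} (insert {v, w} \<Gamma>)"
    proof cases
      case 3
      then show ?thesis using graph_like_subset [OF leaf.IH] by blast
    qed (use leaf e in \<open>auto simp: Pow_insert\<close>)
    from \<sigma> show "finite \<sigma>" by cases (use leaf.IH in \<open>auto simp: graph_like_def\<close>)
    from \<sigma> show "card \<sigma> \<le> 2" by cases (use leaf.IH ne in \<open>auto simp: graph_like_def\<close>)
  qed
qed

text \<open>A leaf \<open>v\<close> is a free face, contained only in its edge, so each attachment is undone by one
  collapse; the last vertex is collapsed by its free face \<open>{}\<close>.\<close>

lemma leaf_built_collapsible: "leaf_built \<Delta> \<Longrightarrow> collapsible \<Delta>"
proof (induction rule: leaf_built.induct)
  case (vertex v)
  have "free_face {{}, {v}} {}" "deletion {{}, {v}} {} = {}"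
    by (auto simp: free_face_def facet_def deletion_def)
  then show ?case unfolding collapsible_def elementary_collapse_def by blast
next
  case (leaf \<Gamma> w v)
  let ?\<Delta> = "insert {v} (insert {v, w} \<Gamma>)"
  have ne: "v \<noteq> w" using leaf by auto
  have \<Gamma>: "graph_like \<Gamma>" and gl: "graph_like ?\<Delta>"
    using leaf_built_graph_like leaf_built.leaf [OF leaf.hyps] leaf.hyps(1) by auto
  have v\<Gamma>: "v \<notin> \<tau>" if "\<tau> \<in> \<Gamma>" for \<tau>
    using graph_like_subset [OF \<Gamma> that, of "{v}"] leaf by auto
  have "facet ?\<Delta> {v, w}" by (rule graph_like_edge_facet [OF gl]) (use ne in auto)
  moreover have v: "\<not> facet ?\<Delta> {v}" using ne by (auto simp: facet_def)
  moreover have "\<phi> = {v, w}" if "facet ?\<Delta> \<phi>" "{v} \<subseteq> \<phi>" for \<phi>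
    using that v v\<Gamma> [of \<phi>] unfolding facet_def by auto
  ultimately have "free_face ?\<Delta> {v}"
    unfolding free_face_def by (metis insertI1 subset_insertI empty_subsetI insert_mono)
  moreover have "deletion ?\<Delta> {v} = \<Gamma>" using v\<Gamma> unfolding deletion_def by auto
  ultimately have "elementary_collapse ?\<Delta> \<Gamma>" unfolding elementary_collapse_def by blast
  then show ?case using leaf.IH unfolding collapsible_def by (rule converse_rtranclp_into_rtranclp)
qed

lemma graph_like_face_in_facet:
  assumes "graph_like \<Delta>" "\<sigma> \<in> \<Delta>"
  obtains \<phi> where "facet \<Delta> \<phi>" "\<sigma> \<subseteq> \<phi>"
proof -
  have "\<exists>\<phi>. (\<phi> \<in> \<Delta> \<and> \<sigma> \<subseteq> \<phi>) \<and> (\<forall>\<tau>. \<tau> \<in> \<Delta> \<and> \<sigma> \<subseteq> \<tau> \<longrightarrow> card \<tau> \<le> card \<phi>)"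
    using assms by (intro ex_has_greatest_nat [where b = 3]) (auto simp: graph_like_def less_Suc_eq_le numeral_3_eq_3 numeral_2_eq_2)
  then obtain \<phi> where \<phi>: "\<phi> \<in> \<Delta>" "\<sigma> \<subseteq> \<phi>" "\<And>\<tau>. \<tau> \<in> \<Delta> \<Longrightarrow> \<sigma> \<subseteq> \<tau> \<Longrightarrow> card \<tau> \<le> card \<phi>"
    by blast
  have "facet \<Delta> \<phi>" unfolding facet_def
  proof (intro conjI ballI impI)
    fix \<tau> assume \<tau>: "\<tau> \<in> \<Delta>" "\<phi> \<subseteq> \<tau>"
    with assms(1) have "finite \<tau>" by (auto simp: graph_like_def)
    then show "\<tau> = \<phi>" using \<tau> \<phi> by (metis card_seteq order_trans)
  qed (fact \<phi>)
  with \<phi> that show thesis by blast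
qed

text \<open>In dimension at most one an edge is always a facet, so only vertices and \<open>{}\<close> can be free. A
  free vertex lies on exactly one edge and is therefore a leaf; if \<open>{}\<close> is free, then the
  complex is a full simplex, that is, a vertex or an edge. The premise on \<open>\<Gamma>\<close> is conditional
  because in the second case the collapse ends in the void complex.\<close>

lemma elementary_collapse_leaf_built:
  assumes \<Delta>: "graph_like \<Delta>" and "elementary_collapse \<Delta> \<Gamma>"
    and IH: "\<Gamma> \<noteq> {} \<Longrightarrow> leaf_built \<Gamma>"
  shows "leaf_built \<Delta>"
proof -
  obtain \<sigma> where \<sigma>: "\<sigma> \<in> \<Delta>" "\<not> facet \<Delta> \<sigma>" and un: "\<exists>!\<phi>. facet \<Delta> \<phi> \<and> \<sigma> \<subseteq> \<phi>"
    and \<Gamma>: "\<Gamma> = deletion \<Delta> \<sigma>"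
    using assms(2) unfolding elementary_collapse_def free_face_def by blast
  from \<Delta> \<sigma>(1) show ?thesis
  proof (cases rule: graph_like_faceE)
    case 1
    obtain \<phi> where \<phi>: "facet \<Delta> \<phi>" and sub: "\<And>\<tau>. \<tau> \<in> \<Delta> \<Longrightarrow> \<tau> \<subseteq> \<phi>"
      using un 1 graph_like_face_in_facet [OF \<Delta>] by (metis empty_subsetI)
    have \<phi>\<Delta>: "\<phi> \<in> \<Delta>" using \<phi> by (simp add: facet_def)
    then have eq: "\<Delta> = Pow \<phi>" using sub graph_like_subset [OF \<Delta>] by blast
    from \<Delta> \<phi>\<Delta> show ?thesis
    proof (cases rule: graph_like_faceE)
      case 1 with \<phi> \<sigma> \<open>\<sigma> = {}\<close> show ?thesis by simp
    next
      case (2 v)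
      then show ?thesis using eq leaf_built.vertex [of v] by (simp add: Pow_insert insert_commute)
    next
      case (3 v w)
      have "leaf_built (insert {v} (insert {v, w} {{}, {w}}))"
        by (rule leaf_built.leaf [OF leaf_built.vertex]) (use 3 in auto)
      then show ?thesis using eq 3 by (simp add: Pow_insert insert_commute)
    qed
  next
    case (2 v)
    obtain \<tau> where \<tau>: "\<tau> \<in> \<Delta>" "{v} \<subseteq> \<tau>" "\<tau> \<noteq> {v}"
      using \<sigma> 2 unfolding facet_def by blast
    from \<Delta> \<tau>(1) have "\<exists>w. {v, w} \<in> \<Delta> \<and> v \<noteq> w"
      by (cases rule: graph_like_faceE) (use \<tau> in \<open>auto simp: insert_commute\<close>)
    then obtain w where vw: "{v, w} \<in> \<Delta>" "v \<noteq> w" by blast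
    have only: "\<rho> = {v} \<or> \<rho> = {v, w}" if "\<rho> \<in> \<Delta>" "v \<in> \<rho>" for \<rho>
    proof (rule disjCI)
      assume "\<rho> \<noteq> {v, w}"
      show "\<rho> = {v}"
        using \<Delta> that(1)
      proof (cases rule: graph_like_faceE)
        case (3 a b)
        then have "facet \<Delta> \<rho>" using graph_like_edge_facet [OF \<Delta>] that by blast
        moreover have "facet \<Delta> {v, w}" using graph_like_edge_facet [OF \<Delta>] vw by blast
        ultimately show ?thesis using un 2 that \<open>\<rho> \<noteq> {v, w}\<close> by auto
      qed (use that in auto)
    qed
    have w: "{w} \<in> \<Gamma>" and v: "{v} \<notin> \<Gamma>"
      using graph_like_subset [OF \<Delta> vw(1), of "{w}"] vw 2 by (auto simp: \<Gamma> deletion_def)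
    have "\<Delta> = insert {v} (insert {v, w} \<Gamma>)"
      using only vw \<sigma> 2 by (auto simp: \<Gamma> deletion_def)
    then show ?thesis using leaf_built.leaf [OF _ w v] IH w by auto
  next
    case (3 v w)
    then show ?thesis using graph_like_edge_facet [OF \<Delta>] \<sigma> by blast
  qed
qed

lemma collapsible_leaf_built:
  assumes "collapsible \<Delta>" "graph_like \<Delta>" "\<Delta> \<noteq> {}"
  shows "leaf_built \<Delta>"
  using assms unfolding collapsible_def
proof (induction rule: converse_rtranclp_induct)
  case (step \<Delta> \<Gamma>)
  have "graph_like \<Gamma>"
    using step.hyps(1) step.prems(1) graph_like_deletion unfolding elementary_collapse_def by blast
  then show ?case
    by (rule elementary_collapse_leaf_built [OF step.prems(1) step.hyps(1) step.IH])
qed simp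

lemma complex_adj_sym: "complex_adj \<Delta> u v \<Longrightarrow> complex_adj \<Delta> v u"
  unfolding complex_adj_def by (simp only: insert_commute [of u v] not_sym simp_thms)

lemma complex_adj_vertex:
  assumes "graph_like \<Delta>" "complex_adj \<Delta> u v"
  shows "u \<in> complex_vertices \<Delta>" "v \<in> complex_vertices \<Delta>"
  using assms graph_like_subset [OF assms(1), of "{u, v}"]
  by (auto simp: complex_adj_def complex_vertices_def)

text \<open>Take a longest path. All neighbours of its first vertex lie on the path, as otherwise the path
  could be prolonged, and a neighbour beyond the second position would close a cycle.\<close>

lemma exists_leaf:
  assumes \<Delta>: "graph_like \<Delta>" and fin: "finite (complex_vertices \<Delta>)"
    and acyclic: "\<nexists>p. graph_cycle \<Delta> p"
    and "v0 \<in> complex_vertices \<Delta>"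
    and nbr: "\<And>v. v \<in> complex_vertices \<Delta> \<Longrightarrow> \<exists>u. complex_adj \<Delta> v u"
  obtains v w where "complex_adj \<Delta> v w" "\<And>u. complex_adj \<Delta> v u \<Longrightarrow> u = w"
proof -
  define path where "path p \<longleftrightarrow> p \<noteq> [] \<and> distinct p \<and> set p \<subseteq> complex_vertices \<Delta> \<and>
    (\<forall>i. Suc i < length p \<longrightarrow> complex_adj \<Delta> (p ! i) (p ! Suc i))" for p
  have "path [v0]" using assms by (simp add: path_def)
  moreover have "\<forall>p. path p \<longrightarrow> length p < Suc (card (complex_vertices \<Delta>))"
    using fin by (metis path_def card_mono distinct_card less_Suc_eq_le)
  ultimately have "\<exists>p. path p \<and> (\<forall>q. path q \<longrightarrow> length q \<le> length p)"
    by (rule ex_has_greatest_nat)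
  then obtain p where p: "path p" and longest: "\<And>q. path q \<Longrightarrow> length q \<le> length p" by blast
  have adj: "complex_adj \<Delta> (p ! i) (p ! Suc i)" if "Suc i < length p" for i
    using p that by (simp add: path_def)
  have p0: "p ! 0 \<in> complex_vertices \<Delta>" using p by (auto simp: path_def)
  have second: "u = p ! 1" if u: "complex_adj \<Delta> (p ! 0) u" for u
  proof -
    have "u \<in> set p"
    proof (rule ccontr)
      assume "u \<notin> set p"
      then have "path (u # p)"
        using p u complex_adj_vertex [OF \<Delta> u] complex_adj_sym [OF u]
        by (auto simp: path_def nth_Cons split: nat.splits)
      then show False using longest [of "u # p"] by simp
    qed
    then obtain j where j: "j < length p" "u = p ! j" by (metis in_set_conv_nth)
    have "j \<noteq> 0" using u j by (metis complex_adj_def)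
    moreover have "\<not> j \<ge> 2"
    proof
      assume "j \<ge> 2"
      have "graph_cycle \<Delta> (take (Suc j) p)"
        unfolding graph_cycle_def
      proof (intro conjI allI impI)
        show "distinct (take (Suc j) p)" using p by (simp add: path_def)
        fix i assume "i < length (take (Suc j) p)"
        then have "i < j \<or> i = j" using j by auto
        then show "complex_adj \<Delta> (take (Suc j) p ! i) (take (Suc j) p ! (Suc i mod length (take (Suc j) p)))"
          using j adj [of i] complex_adj_sym [OF u] by (auto simp: min_absorb2)
      qed (use \<open>j \<ge> 2\<close> j in auto)
      with acyclic show False by blast
    qed
    ultimately have "j = 1" by linarith
    with j show ?thesis by simp
  qed
  obtain w where w: "complex_adj \<Delta> (p ! 0) w" using nbr p0 by blast
  show thesis by (rule that [OF w]) (metis second w)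
qed

text \<open>A path between two other vertices that visits the leaf \<open>v\<close> must enter and leave it through \<open>w\<close>,
  so the visit can be cut out.\<close>

lemma graph_tree_delete_leaf:
  assumes tree: "graph_tree \<Delta>" and \<Delta>: "graph_like \<Delta>"
    and vw: "complex_adj \<Delta> v w" and only: "\<And>u. complex_adj \<Delta> v u \<Longrightarrow> u = w"
  shows "graph_tree (deletion \<Delta> {v})"
proof -
  let ?\<Gamma> = "deletion \<Delta> {v}"
  have adj: "complex_adj ?\<Gamma> x y \<longleftrightarrow> complex_adj \<Delta> x y \<and> x \<noteq> v \<and> y \<noteq> v" for x y
    by (auto simp: complex_adj_def deletion_def)
  have vert: "complex_vertices ?\<Gamma> = complex_vertices \<Delta> - {v}"
    by (auto simp: complex_vertices_def deletion_def)
  \<comment> \<open>While the path sits at \<open>v\<close>, the shortened path waits at \<open>w\<close>.\<close>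
  have detour: "(y \<noteq> v \<longrightarrow> (complex_adj ?\<Gamma>)\<^sup>*\<^sup>* x y) \<and> (y = v \<longrightarrow> (complex_adj ?\<Gamma>)\<^sup>*\<^sup>* x w)"
    if "(complex_adj \<Delta>)\<^sup>*\<^sup>* x y" "x \<noteq> v" for x y
    using that
  proof (induction rule: rtranclp_induct)
    case (step y z)
    show ?case
    proof (cases "y = v")
      case True
      then have "z = w" "z \<noteq> v" using only step.hyps by (auto simp: complex_adj_def)
      then show ?thesis using step True by simp
    next
      case y: False
      show ?thesis
      proof (cases "z = v")
        case True
        then have "y = w" using only complex_adj_sym step.hyps by metis
        then show ?thesis using step True y by simp
      next
        case False
        then have "complex_adj ?\<Gamma> y z" using adj y step.hyps by blast
        then show ?thesis using step y False by (auto intro: rtranclp.rtrancl_into_rtrancl)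
      qed
    qed
  qed simp
  have "w \<in> complex_vertices ?\<Gamma>"
    using vw complex_adj_vertex [OF \<Delta> vw] unfolding vert by (auto simp: complex_adj_def)
  moreover have "(complex_adj ?\<Gamma>)\<^sup>*\<^sup>* x y"
    if "x \<in> complex_vertices ?\<Gamma>" "y \<in> complex_vertices ?\<Gamma>" for x y
    using that detour [of x y] tree unfolding vert graph_tree_def graph_connected_def by blast
  moreover have "graph_cycle \<Delta> p" if "graph_cycle ?\<Gamma> p" for p
    using that adj unfolding graph_cycle_def by blast
  ultimately show ?thesis using tree unfolding graph_tree_def graph_connected_def by blast
qed

lemma graph_tree_leaf_built:
  assumes "graph_tree \<Delta>" "graph_like \<Delta>" "finite (complex_vertices \<Delta>)"
  shows "leaf_built \<Delta>"
  using assms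
proof (induction "card (complex_vertices \<Delta>)" arbitrary: \<Delta> rule: less_induct)
  case less
  note tree = less.prems(1) and \<Delta> = less.prems(2) and fin = less.prems(3)
  obtain v0 where v0: "v0 \<in> complex_vertices \<Delta>"
    using tree by (auto simp: graph_tree_def graph_connected_def)
  show ?case
  proof (cases "complex_vertices \<Delta> = {v0}")
    case True
    have "x = v0" if "\<sigma> \<in> \<Delta>" "x \<in> \<sigma>" for \<sigma> x
      using True graph_like_subset [OF \<Delta> that(1), of "{x}"] that by (auto simp: complex_vertices_def)
    then have "\<sigma> = {} \<or> \<sigma> = {v0}" if "\<sigma> \<in> \<Delta>" for \<sigma> using that by blast
    moreover have "{v0} \<in> \<Delta>" using v0 by (simp add: complex_vertices_def)
    moreover have "{} \<in> \<Delta>" using graph_like_subset [OF \<Delta> \<open>{v0} \<in> \<Delta>\<close>] by blast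
    ultimately have "\<Delta> = {{}, {v0}}" by blast
    then show ?thesis using leaf_built.vertex by metis
  next
    case False
    have nbr: "\<exists>u. complex_adj \<Delta> v u" if v: "v \<in> complex_vertices \<Delta>" for v
    proof -
      obtain x where x: "x \<in> complex_vertices \<Delta>" "x \<noteq> v" using False v0 by blast
      then have "(complex_adj \<Delta>)\<^sup>*\<^sup>* v x"
        using tree v by (auto simp: graph_tree_def graph_connected_def)
      then show ?thesis using x by (metis converse_rtranclpE)
    qed
    have acyclic: "\<nexists>p. graph_cycle \<Delta> p" using tree by (simp add: graph_tree_def)
    obtain v w where vw: "complex_adj \<Delta> v w" and only: "\<And>u. complex_adj \<Delta> v u \<Longrightarrow> u = w"
      using exists_leaf [OF \<Delta> fin acyclic v0 nbr] by blast
    let ?\<Gamma> = "deletion \<Delta> {v}"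
    have vs: "v \<in> complex_vertices \<Delta>" "w \<in> complex_vertices \<Delta>" "v \<noteq> w"
      using vw complex_adj_vertex [OF \<Delta> vw] by (auto simp: complex_adj_def)
    have vert: "complex_vertices ?\<Gamma> = complex_vertices \<Delta> - {v}"
      by (auto simp: complex_vertices_def deletion_def)
    have "leaf_built ?\<Gamma>"
    proof (rule less.hyps)
      show "card (complex_vertices ?\<Gamma>) < card (complex_vertices \<Delta>)"
        unfolding vert by (rule card_Diff1_less [OF fin vs(1)])
    qed (use vert fin graph_tree_delete_leaf [OF tree \<Delta> vw only] graph_like_deletion [OF \<Delta>] in auto)
    moreover have w: "{w} \<in> ?\<Gamma>" "{v} \<notin> ?\<Gamma>"
      using vs by (auto simp: complex_vertices_def deletion_def)
    ultimately have "leaf_built (insert {v} (insert {v, w} ?\<Gamma>))" by (rule leaf_built.leaf)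
    moreover have "\<Delta> = insert {v} (insert {v, w} ?\<Gamma>)"
    proof
      show "insert {v} (insert {v, w} ?\<Gamma>) \<subseteq> \<Delta>"
        using vw vs by (auto simp: deletion_def complex_adj_def complex_vertices_def)
      have "\<sigma> = {v} \<or> \<sigma> = {v, w}" if "\<sigma> \<in> \<Delta>" "v \<in> \<sigma>" for \<sigma>
        using \<Delta> that(1)
      proof (cases rule: graph_like_faceE)
        case (3 a b)
        with that obtain u where "\<sigma> = {v, u}" "v \<noteq> u" by auto
        with that only [of u] show ?thesis by (auto simp: complex_adj_def)
      qed (use that in auto)
      then show "\<Delta> \<subseteq> insert {v} (insert {v, w} ?\<Gamma>)" by (auto simp: deletion_def)
    qed
    ultimately show ?thesis by metis
  qed
qed

text \<open>The order of attachment numbers the vertices so that each one but the first has exactly one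
  earlier neighbour, its parent.\<close>

lemma leaf_built_enumeration:
  assumes "leaf_built \<Delta>"
  obtains n and g :: "nat \<Rightarrow> 'a" and p :: "nat \<Rightarrow> nat" where "0 < n" "inj_on g {..<n}"
    "\<forall>k\<in>{1..<n}. p k < k"
    "\<Delta> = insert {} ((\<lambda>k. {g k}) ` {..<n} \<union> (\<lambda>k. {g k, g (p k)}) ` {1..<n})"
  using assms
proof (induction arbitrary: thesis rule: leaf_built.induct)
  case (vertex v)
  show ?case by (rule vertex [of 1 "\<lambda>_. v"]) (auto simp: inj_on_def)
next
  case (leaf \<Gamma> w v)
  obtain n and g :: "nat \<Rightarrow> 'a" and p where n: "0 < n" "inj_on g {..<n}" and p: "\<forall>k\<in>{1..<n}. p k < k"
    and \<Gamma>: "\<Gamma> = insert {} ((\<lambda>k. {g k}) ` {..<n} \<union> (\<lambda>k. {g k, g (p k)}) ` {1..<n})"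
    by (rule leaf.IH)
  have single: "x \<in> g ` {..<n}" if x: "{x} \<in> \<Gamma>" for x
  proof -
    from x consider k where "k < n" "{x} = {g k}" | k where "1 \<le> k" "k < n" "{x} = {g k, g (p k)}"
      unfolding \<Gamma> by auto
    then show ?thesis by cases auto
  qed
  obtain m where m: "m < n" "w = g m" using single [OF leaf.hyps(2)] by blast
  have v: "v \<notin> g ` {..<n}" using leaf.hyps(3) unfolding \<Gamma> by auto
  let ?g = "g(n := v)" and ?p = "p(n := m)"
  have pn: "p k < n" if "k \<in> {1..<n}" for k using p that by fastforce
  have I1: "(\<lambda>k. {?g k}) ` {..<Suc n} = insert {v} ((\<lambda>k. {g k}) ` {..<n})"
    by (auto simp: lessThan_Suc)
  have edges: "(\<lambda>k. {?g k, ?g (?p k)}) ` {1..<n} = (\<lambda>k. {g k, g (p k)}) ` {1..<n}"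
    by (rule image_cong) (use pn in fastforce)+
  have "{1..<Suc n} = insert n {1..<n}" using n by auto
  then have I2: "(\<lambda>k. {?g k, ?g (?p k)}) ` {1..<Suc n} = insert {v, w} ((\<lambda>k. {g k, g (p k)}) ` {1..<n})"
    using m by (simp only: image_insert edges) simp
  show ?case
  proof (rule leaf.prems [of "Suc n" ?g ?p])
    show "inj_on ?g {..<Suc n}"
      using n v by (auto simp: inj_on_def less_Suc_eq)
    show "\<forall>k\<in>{1..<Suc n}. ?p k < k" using m p by (auto simp: less_Suc_eq)
    show "insert {v} (insert {v, w} \<Gamma>) = insert {} ((\<lambda>k. {?g k}) ` {..<Suc n} \<union> (\<lambda>k. {?g k, ?g (?p k)}) ` {1..<Suc n})"
      unfolding I1 I2 \<Gamma> by blast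
  qed simp
qed

section \<open>Convex unions have acyclic nerves\<close>

text \<open>Two logarithms of one function differ by a continuous function with values in the discrete set
  \<open>2\<pi>i\<int>\<close>.\<close>

lemma exp_lifts_differ_by_constant:
  fixes g q :: "'v::topological_space \<Rightarrow> complex"
  assumes "connected S" "continuous_on S g" "continuous_on S q"
    and eq: "\<And>x. x \<in> S \<Longrightarrow> exp (g x) = exp (q x)"
  obtains K where "\<And>x. x \<in> S \<Longrightarrow> g x = K + q x"
proof -
  have "(\<lambda>x. g x - q x) constant_on S"
  proof (rule continuous_discrete_range_constant)
    show "continuous_on S (\<lambda>x. g x - q x)" using assms by (intro continuous_intros)
    fix x assume x: "x \<in> S"
    have "2 * pi \<le> norm (g y - q y - (g x - q x))"
      if y: "y \<in> S" "g y - q y \<noteq> g x - q x" for y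
    proof (rule ccontr)
      assume "\<not> 2 * pi \<le> norm (g y - q y - (g x - q x))"
      then have "\<bar>Im (g y - q y) - Im (g x - q x)\<bar> < 2 * pi"
        using abs_Im_le_cmod [of "g y - q y - (g x - q x)"] by simp
      moreover have "exp (g y - q y) = exp (g x - q x)" using eq x y by (simp add: exp_diff)
      ultimately show False using exp_complex_eqI y by blast
    qed
    then show "\<exists>e>0. \<forall>y. y \<in> S \<and> g y - q y \<noteq> g x - q x \<longrightarrow> e \<le> norm (g y - q y - (g x - q x))"
      by (intro exI [of _ "2 * pi"]) auto
  qed (fact assms(1))
  then show thesis using that unfolding constant_on_def by (metis diff_add_cancel add.commute)
qed

text \<open>The quotient of the distances to \<open>A - Q\<close> and \<open>A - P\<close> works: these sets are relatively closed in
  \<open>A\<close>, and no point of \<open>P \<union> Q\<close> lies in both.\<close>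

lemma urysohn_on_union:
  fixes A :: "'v::metric_space set"
  assumes op: "openin (top_of_set A) P" "openin (top_of_set A) Q"
    and ne: "P - Q \<noteq> {}" "Q - P \<noteq> {}"
  obtains t :: "'v \<Rightarrow> real" where "continuous_on (P \<union> Q) t"
    "\<And>x. x \<in> P - Q \<Longrightarrow> t x = 0" "\<And>x. x \<in> Q - P \<Longrightarrow> t x = 1"
proof -
  have sub: "P \<subseteq> A" "Q \<subseteq> A" using op openin_imp_subset by auto
  have zero: "infdist x (A - R) = 0 \<longleftrightarrow> x \<notin> R" if x: "x \<in> A" and R: "openin (top_of_set A) R" "A - R \<noteq> {}" for x R
  proof -
    obtain C where C: "closed C" "A - R = A \<inter> C"
      using R(1) by (metis closedin_closed closedin_diff closedin_topspace topspace_euclidean_subtopology)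
    have "x \<in> closure (A - R) \<longleftrightarrow> x \<in> A - R"
      using C x closure_subset [of "A - R"] closure_minimal [of "A - R" C] by blast
    then show ?thesis using in_closure_iff_infdist_zero [OF R(2)] x by auto
  qed
  have neP: "A - P \<noteq> {}" and neQ: "A - Q \<noteq> {}" using sub ne by auto
  define t where "t x = infdist x (A - Q) / (infdist x (A - Q) + infdist x (A - P))" for x
  show thesis
  proof
    show "continuous_on (P \<union> Q) t"
      unfolding t_def
    proof (intro continuous_intros ballI)
      fix x assume x: "x \<in> P \<union> Q"
      then have "infdist x (A - Q) \<noteq> 0 \<or> infdist x (A - P) \<noteq> 0"
        using zero [of x P] zero [of x Q] op neP neQ sub by blast
      then show "infdist x (A - Q) + infdist x (A - P) \<noteq> 0"
        using infdist_nonneg [of x "A - Q"] infdist_nonneg [of x "A - P"] by linarith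
    qed
    show "t x = 0" if "x \<in> P - Q" for x
      using zero [of x Q] that op neQ sub by (auto simp: t_def)
    show "t x = 1" if "x \<in> Q - P" for x
      using zero [of x Q] zero [of x P] that op neQ neP sub by (auto simp: t_def)
  qed
qed

text \<open>Let \<open>a\<close> and \<open>b\<close> be the two ends of the edge that closes the cycle. The map \<open>h\<close> to the circle
  that winds around once while a point crosses from \<open>U a\<close> to \<open>U b\<close>, and that is \<open>1\<close> outside \<open>U a \<union> U b\<close>, is
  continuous on \<open>A\<close>: a third set meets \<open>U a \<union> U b\<close> only in points that lie in just one
  of \<open>U a\<close> and \<open>U b\<close>. As \<open>A\<close> is convex, \<open>h\<close> has a logarithm \<open>g\<close>. It gains \<open>2\<pi>i\<close> when passing
  directly from \<open>U a\<close> to \<open>U b\<close>, but nothing on the detour along the cycle.\<close>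

lemma convex_union_no_cycle:
  fixes U :: "'i \<Rightarrow> 'v::real_normed_vector set" and V :: "'i set"
  defines "A \<equiv> \<Union>i\<in>V. U i"
  assumes op: "\<And>i. i \<in> V \<Longrightarrow> openin (top_of_set A) (U i)"
    and conv: "\<And>i. i \<in> V \<Longrightarrow> convex (U i)" and convA: "convex A"
    and triple: "\<And>i j k. \<lbrakk>i \<in> V; j \<in> V; k \<in> V; i \<noteq> j; j \<noteq> k; i \<noteq> k\<rbrakk> \<Longrightarrow> U i \<inter> U j \<inter> U k = {}"
    and p: "3 \<le> length p" "distinct p" "set p \<subseteq> V"
    and cyc: "\<And>i. i < length p \<Longrightarrow> U (p ! i) \<inter> U (p ! (Suc i mod length p)) \<noteq> {}"
  shows False
proof -
  define m where "m = length p"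
  define a b where "a = p ! 0" and "b = p ! (m - 1)"
  have mem: "p ! i \<in> V" if "i < m" for i using p that by (auto simp: m_def)
  have neq: "p ! i \<noteq> p ! j" if "i < m" "j < m" "i \<noteq> j" for i j
    using p that by (simp add: m_def nth_eq_iff_index_eq)
  have m3: "3 \<le> m" using p by (simp add: m_def)
  have ab: "a \<in> V" "b \<in> V" "a \<noteq> b" using mem neq m3 by (auto simp: a_def b_def)
  have meet: "U (p ! i) \<inter> U (p ! Suc i) \<noteq> {}" if "Suc i < m" for i
    using cyc [of i] that by (simp add: m_def)
  have "U b \<inter> U a \<noteq> {}" 
  proof -
    have "Suc (m - 1) = m" using m3 by simp
    then show ?thesis using cyc [of "m - 1"] m3 by (simp add: a_def b_def m_def)
  qed
  then obtain z where z: "z \<in> U a" "z \<in> U b" by blast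
  obtain x1 where x1: "x1 \<in> U a" "x1 \<in> U (p ! 1)" using meet [of 0] m3 by (auto simp: a_def)
  have x1b: "x1 \<notin> U b"
    using triple [of a "p ! 1" b] x1 ab mem [of 1] neq [of 1 0] neq [of 1 "m - 1"] m3
    by (auto simp: a_def b_def)
  obtain x2 where x2: "x2 \<in> U (p ! (m - 2))" "x2 \<in> U b"
    using meet [of "m - 2"] m3 by (auto simp: b_def Suc_diff_Suc numeral_2_eq_2)
  have x2a: "x2 \<notin> U a"
    using triple [of a "p ! (m - 2)" b] x2 ab mem [of "m - 2"] neq [of "m - 2" 0] neq [of "m - 2" "m - 1"] m3
    by (auto simp: a_def b_def)
  obtain t :: "'v \<Rightarrow> real" where t: "continuous_on (U a \<union> U b) t"
    and t0: "\<And>x. x \<in> U a - U b \<Longrightarrow> t x = 0" and t1: "\<And>x. x \<in> U b - U a \<Longrightarrow> t x = 1"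
    using urysohn_on_union [OF op [OF ab(1)] op [OF ab(2)]] x1 x1b x2 x2a by blast
  \<comment> \<open>Local logarithms, one on each \<open>U i\<close>, of the map \<open>h\<close> defined below.\<close>
  define q where "q i x = (if i \<in> {a, b} then 2 * pi * \<i> * complex_of_real (t x) else 0)" for i x
  have cq: "continuous_on (U i) (q i)" for i
  proof (cases "i \<in> {a, b}")
    case True
    then have "continuous_on (U i) t" using continuous_on_subset [OF t] by blast
    then show ?thesis using True unfolding q_def by (auto intro!: continuous_intros)
  qed (auto simp: q_def)
  define h where "h x = (if x \<in> U a \<union> U b then exp (q a x) else 1)" for x
  have one: "exp (q a x) = 1" if "x \<in> U i" "x \<in> U a \<union> U b" "i \<in> V" "i \<notin> {a, b}" for i x
  proof -
    have "x \<notin> U a \<inter> U b" using triple [of i a b] that ab by auto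
    with that have "t x = 0 \<or> t x = 1" using t0 t1 by blast
    then show ?thesis by (auto simp: q_def)
  qed
  have hq: "h x = exp (q i x)" if "i \<in> V" "x \<in> U i" for i x
    using that one [of x i] by (auto simp: h_def q_def)
  have ch: "continuous_on A h"
  proof -
    have "continuous_map (top_of_set A) euclidean h"
    proof (rule pasting_lemma [where I = V and T = U and f = "\<lambda>i x. exp (q i x)"])
      show "continuous_map (subtopology (top_of_set A) (U i)) euclidean (\<lambda>x. exp (q i x))"
        if "i \<in> V" for i
      proof -
        have "A \<inter> U i = U i" using that by (auto simp: A_def)
        then show ?thesis using cq [of i] by (auto simp: subtopology_subtopology intro!: continuous_intros)
      qed
      show "exp (q i x) = exp (q j x)"
        if "i \<in> V" "j \<in> V" "x \<in> topspace (top_of_set A) \<inter> U i \<inter> U j" for i j x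
        using that hq [of i x] hq [of j x] by auto
      show "\<exists>j. j \<in> V \<and> x \<in> U j \<and> h x = exp (q j x)"
        if "x \<in> topspace (top_of_set A)" for x
        using that hq by (auto simp: A_def)
    qed (use op in auto)
    then show ?thesis by simp
  qed
  obtain g where g: "continuous_on A g" "\<And>x. x \<in> A \<Longrightarrow> h x = exp (g x)"
  proof (rule continuous_logarithm_on_contractible [OF ch convex_imp_contractible [OF convA]])
    show "h z \<noteq> 0" for z by (simp add: h_def)
  qed blast
  have "\<exists>K. \<forall>x\<in>U i. g x = K + q i x" if i: "i \<in> V" for i
  proof -
    have sub: "U i \<subseteq> A" using i by (auto simp: A_def)
    have "exp (g x) = exp (q i x)" if "x \<in> U i" for x
      using hq [OF i that] g(2) sub that by auto
    then show ?thesis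
      using exp_lifts_differ_by_constant [OF convex_connected [OF conv [OF i]] continuous_on_subset [OF g(1) sub] cq]
      by metis
  qed
  then obtain K where K: "\<And>i x. i \<in> V \<Longrightarrow> x \<in> U i \<Longrightarrow> g x = K i + q i x" by metis
  have nab: "p ! i \<notin> {a, b}" if "1 \<le> i" "i \<le> m - 2" for i
    using neq [of i 0] neq [of i "m - 1"] that m3 by (auto simp: a_def b_def)
  have walk: "K (p ! i) = K (p ! 1)" if "1 \<le> i" "i \<le> m - 2" for i
    using that
  proof (induction i rule: dec_induct)
    case (step i)
    have "Suc i < m" using step.prems m3 by linarith
    then obtain x where x: "x \<in> U (p ! i)" "x \<in> U (p ! Suc i)" using meet by blast
    have "q (p ! i) x = 0" "q (p ! Suc i) x = 0"
      using nab [of i] nab [of "Suc i"] step by (auto simp: q_def)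
    then show ?case
      using K [OF _ x(1)] K [OF _ x(2)] mem [of i] mem [of "Suc i"] step by simp
  qed simp
  have "K a = K b" using K [OF ab(1) z(1)] K [OF ab(2) z(2)] by (simp add: q_def)
  moreover have "K a = K (p ! 1)"
    using K [OF ab(1) x1(1)] K [OF _ x1(2)] t0 [of x1] x1 x1b mem [of 1] nab [of 1] m3
    by (auto simp: q_def)
  moreover have "K (p ! (m - 2)) = K b + 2 * pi * \<i>"
    using K [OF ab(2) x2(2)] K [OF _ x2(1)] t1 [of x2] x2 x2a mem [of "m - 2"] nab [of "m - 2"] m3
    by (auto simp: q_def)
  moreover have "K (p ! (m - 2)) = K (p ! 1)" by (rule walk) (use m3 in auto)
  ultimately show False by simp
qed

text \<open>Otherwise the sets reachable from \<open>u\<close> and the remaining ones would split the connected union into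
  two disjoint nonempty open parts.\<close>

lemma convex_union_nerve_connected:
  fixes U :: "'i \<Rightarrow> 'v::real_normed_vector set" and V :: "'i set"
  defines "A \<equiv> \<Union>i\<in>V. U i"
  assumes op: "\<And>i. i \<in> V \<Longrightarrow> openin (top_of_set A) (U i)" and convA: "convex A"
    and uv: "u \<in> V" "v \<in> V" "U u \<noteq> {}" "U v \<noteq> {}"
  shows "(\<lambda>i j. i \<in> V \<and> j \<in> V \<and> i \<noteq> j \<and> U i \<inter> U j \<noteq> {})\<^sup>*\<^sup>* u v" (is "?R\<^sup>*\<^sup>* u v")
proof (rule ccontr)
  assume no: "\<not> ?R\<^sup>*\<^sup>* u v"
  define X where "X = {i \<in> V. ?R\<^sup>*\<^sup>* u i}"
  define P Q where "P = (\<Union>i\<in>X. U i)" and "Q = (\<Union>i\<in>V - X. U i)"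
  have "openin (top_of_set A) P" "openin (top_of_set A) Q"
    unfolding P_def Q_def using op by (auto simp: X_def intro!: openin_Union)
  moreover have "P \<union> Q = A" unfolding P_def Q_def A_def X_def by blast
  moreover have "P \<inter> Q = {}"
  proof (rule ccontr)
    assume "P \<inter> Q \<noteq> {}"
    then obtain x i j where x: "x \<in> U i" "x \<in> U j" "i \<in> X" "j \<in> V" "j \<notin> X"
      unfolding P_def Q_def by blast
    then have step: "?R i j" and i: "?R\<^sup>*\<^sup>* u i" by (auto simp: X_def)
    from i step have "?R\<^sup>*\<^sup>* u j" by (rule rtranclp.rtrancl_into_rtrancl)
    with x show False by (simp add: X_def)
  qed
  moreover have "P \<noteq> {}" using uv by (auto simp: P_def X_def)
  moreover have "Q \<noteq> {}" using uv no by (auto simp: Q_def X_def)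
  ultimately show False
    using convex_connected [OF convA] unfolding connected_openin by blast
qed

lemma convex_union_representable_graph_tree:
  assumes rep: "convex_union_representable V \<Delta>" and small: "\<And>\<sigma>. \<sigma> \<in> \<Delta> \<Longrightarrow> card \<sigma> \<le> 2"
    and ne: "complex_vertices \<Delta> \<noteq> {}"
  shows "graph_tree \<Delta>"
proof -
  obtain d and U :: "'a \<Rightarrow> (nat \<Rightarrow>\<^sub>0 real) set"
    where op: "\<And>i. i \<in> V \<Longrightarrow> openin (top_of_set (coord_space d)) (U i)"
      and conv: "\<And>i. i \<in> V \<Longrightarrow> convex (U i)" and convA: "convex (\<Union>i\<in>V. U i)"
      and \<Delta>: "\<Delta> = nerve V U"
    using rep unfolding convex_union_representable_def by blast
  let ?A = "\<Union>i\<in>V. U i"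
  have opA: "openin (top_of_set ?A) (U i)" if "i \<in> V" for i
    by (rule openin_subset_trans [OF op [OF that]]) (use that op openin_imp_subset in blast)+
  have vert: "v \<in> complex_vertices \<Delta> \<longleftrightarrow> v \<in> V \<and> U v \<noteq> {}" for v
    by (simp add: complex_vertices_def \<Delta> nerve_def nerve_inter_def)
  have adj: "complex_adj \<Delta> u v \<longleftrightarrow> u \<in> V \<and> v \<in> V \<and> u \<noteq> v \<and> U u \<inter> U v \<noteq> {}" for u v
    by (auto simp: complex_adj_def \<Delta> nerve_def nerve_inter_def)
  then have adj': "complex_adj \<Delta> = (\<lambda>u v. u \<in> V \<and> v \<in> V \<and> u \<noteq> v \<and> U u \<inter> U v \<noteq> {})"
    by (intro ext)
  have "graph_connected \<Delta>"
    unfolding graph_connected_def adj' vert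
    using ne convex_union_nerve_connected [of V U, OF opA convA] vert by auto
  moreover have "\<not> graph_cycle \<Delta> p" for p
  proof
    assume p: "graph_cycle \<Delta> p"
    have tri: "U i \<inter> U j \<inter> U k = {}"
      if "i \<in> V" "j \<in> V" "k \<in> V" "i \<noteq> j" "j \<noteq> k" "i \<noteq> k" for i j k
      using small [of "{i, j, k}"] that by (auto simp: \<Delta> nerve_def nerve_inter_def)
    have "set p \<subseteq> V" using p unfolding graph_cycle_def adj by (auto simp: in_set_conv_nth)
    then show False
      using convex_union_no_cycle [of V U p, OF opA conv convA tri] p
      unfolding graph_cycle_def adj by blast
  qed
  ultimately show ?thesis by (simp add: graph_tree_def)
qed

section \<open>Polyhedral representation of rooted trees\<close>

abbreviation coord :: "(nat \<Rightarrow>\<^sub>0 real) \<Rightarrow> nat \<Rightarrow> real" where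
  "coord \<equiv> Poly_Mapping.lookup"

lemma coord_scaleR [simp]: "coord (r *\<^sub>R x) i = r * coord x i"
proof -
  have "finite {i. r *\<^sub>R coord x i \<noteq> 0}"
    by (rule finite_subset [OF _ finite_keys [of x]]) (auto simp: in_keys_iff)
  then show ?thesis by (simp add: scaleR_poly_mapping_def)
qed

lemma continuous_on_coord [continuous_intros]: "continuous_on S (\<lambda>y. coord y i)"
proof (rule linear_continuous_on, rule bounded_linear_intro [where K = 1])
  fix x :: "nat \<Rightarrow>\<^sub>0 real"
  have "\<bar>coord x i\<bar> \<le> (\<Sum>n\<in>Poly_Mapping.keys x. \<bar>coord x n\<bar>)"
    by (cases "i \<in> Poly_Mapping.keys x") (auto intro: member_le_sum simp: in_keys_iff sum_nonneg)
  then show "norm (coord x i) \<le> norm x * 1"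
    by (simp add: norm_poly_mapping_def dist_poly_mapping_def)
qed (simp_all add: lookup_add)

lemma convex_coord_space: "convex (coord_space d)"
proof -
  have "x \<in> coord_space d \<longleftrightarrow> (\<forall>i\<ge>d. coord x i = 0)" for x
    unfolding coord_space_def subset_iff in_keys_iff by (auto simp: not_le [symmetric])
  then show ?thesis by (simp add: convex_def lookup_add)
qed

lemma coord_space_point:
  obtains y where "y \<in> coord_space n" "\<And>i. i < n \<Longrightarrow> coord y i = f i"
proof -
  let ?f = "\<lambda>i. if i < n then f i else 0"
  have "finite {i. ?f i \<noteq> 0}" by (rule finite_subset [of _ "{..<n}"]) auto
  then have "coord (Abs_poly_mapping ?f) = ?f" by (rule lookup_Abs_poly_mapping)
  then show thesis
    by (intro that [of "Abs_poly_mapping ?f"]) (auto simp: coord_space_def in_keys_iff split: if_splits)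
qed

lemma convex_coord_linear:
  "convex {y. coord y i < coord y j}" "convex {y. coord y i + coord y j < r}"
  "convex {y. coord y i < r}" "convex {y. r < coord y i}"
proof -
  have lin: "linear (\<lambda>y. coord y i - coord y j)" "linear (\<lambda>y. coord y i + coord y j)"
    "linear (\<lambda>y. coord y i)"
    by (auto intro!: linearI simp: lookup_add algebra_simps)
  show "convex {y. coord y i < coord y j}"
    using convex_linear_vimage [OF lin(1) convex_real_interval(4) [of 0]] by (simp add: vimage_def)
  show "convex {y. coord y i + coord y j < r}"
    using convex_linear_vimage [OF lin(2) convex_real_interval(4) [of r]] by (simp add: vimage_def)
  show "convex {y. coord y i < r}"
    using convex_linear_vimage [OF lin(3) convex_real_interval(4) [of r]] by (simp add: vimage_def)
  show "convex {y. r < coord y i}"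
    using convex_linear_vimage [OF lin(3) convex_real_interval(3) [of r]] by (simp add: vimage_def)
qed

text \<open>Rooted trees on \<open>{..<n}\<close> with root \<open>0\<close>, given by parent pointers towards smaller numbers.\<close>

locale parent_tree =
  fixes n :: nat and p :: "nat \<Rightarrow> nat"
  assumes n: "0 < n" and parent_less: "\<And>k. 0 < k \<Longrightarrow> k < n \<Longrightarrow> p k < k"
begin

text \<open>Read the coordinate \<open>y\<^sub>c\<close> as the amount of mass in the branch above \<open>c\<close>. The inequalities of
  \<open>body\<close> say that mass shrinks along branches and that two sibling branches cannot both be heavy,
  so the heavy vertices form a chain starting at the root. The cell of \<open>k\<close> asks that \<open>k\<close> be heavy
  but none of its children too heavy. The windows \<open>(2c, 2c+1)\<close> in which a child and its parent
  overlap are pairwise disjoint and move up along the tree, which leaves no room for three cells to meet.\<close>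

definition body :: "(nat \<Rightarrow>\<^sub>0 real) set" where
  "body = {y \<in> coord_space n. (\<forall>c\<in>{1..<n}. coord y c < coord y (p c)) \<and>
     (\<forall>c\<in>{1..<n}. \<forall>c'\<in>{1..<n}. c \<noteq> c' \<and> p c = p c' \<longrightarrow> coord y c + coord y c' < 1)}"

definition cell :: "nat \<Rightarrow> (nat \<Rightarrow>\<^sub>0 real) set" where
  "cell k = {y \<in> body. (0 < k \<longrightarrow> 2 * real k < coord y k) \<and>
     (\<forall>c\<in>{1..<n}. p c = k \<longrightarrow> coord y c < 2 * real c + 1)}"

lemma convex_body: "convex body"
proof -
  have "body = coord_space n \<inter> (\<Inter>c\<in>{1..<n}. {y. coord y c < coord y (p c)}) \<inter>
     (\<Inter>c\<in>{1..<n}. \<Inter>c'\<in>{c'\<in>{1..<n}. c \<noteq> c' \<and> p c = p c'}. {y. coord y c + coord y c' < 1})"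
    unfolding body_def by auto
  then show ?thesis
    by (auto intro!: convex_Int convex_INT convex_coord_space convex_coord_linear)
qed

lemma convex_cell: "convex (cell k)"
proof -
  have "cell k = body \<inter> (\<Inter>i\<in>{i. i = k \<and> 0 < k}. {y. 2 * real k < coord y k}) \<inter>
     (\<Inter>c\<in>{c\<in>{1..<n}. p c = k}. {y. coord y c < 2 * real c + 1})"
    unfolding cell_def by auto
  then show ?thesis
    by (auto intro!: convex_Int convex_INT convex_body convex_coord_linear)
qed

lemma openin_cell: "openin (top_of_set (coord_space n)) (cell k)"
proof -
  define W where "W = (\<Inter>c\<in>{1..<n}. {y. coord y c < coord y (p c)}) \<inter>
     (\<Inter>c\<in>{1..<n}. \<Inter>c'\<in>{c'\<in>{1..<n}. c \<noteq> c' \<and> p c = p c'}. {y. coord y c + coord y c' < 1}) \<inter>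
     (\<Inter>i\<in>{i. i = k \<and> 0 < k}. {y. 2 * real k < coord y k}) \<inter>
     (\<Inter>c\<in>{c\<in>{1..<n}. p c = k}. {y. coord y c < 2 * real c + 1})"
  have "open W"
    unfolding W_def by (intro open_Int open_INT ballI open_Collect_less continuous_intros) auto
  moreover have "cell k = coord_space n \<inter> W"
    unfolding cell_def body_def W_def by auto
  ultimately show ?thesis by (auto simp: openin_open)
qed

text \<open>A vertex \<open>k\<close> with coordinate at least \<open>2k + 1\<close> lies above its upper threshold. The largest such
  vertex has no child above its own, because children have
  larger numbers. If there is none, the root serves, as it has no
  threshold to pass.\<close>

lemma body_eq_Union_cells: "body = (\<Union>k<n. cell k)"
proof
  show "body \<subseteq> (\<Union>k<n. cell k)"
  proof
    fix y assume y: "y \<in> body"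
    define T where "T = insert 0 {k \<in> {1..<n}. 2 * real k + 1 \<le> coord y k}"
    define k where "k = Max T"
    have fin: "finite T" and "T \<noteq> {}" by (auto simp: T_def)
    then have kT: "k \<in> T" unfolding k_def by (rule Max_in)
    have "coord y c < 2 * real c + 1" if c: "c \<in> {1..<n}" "p c = k" for c
    proof (rule ccontr)
      assume "\<not> coord y c < 2 * real c + 1"
      then have "c \<in> T" using c by (simp add: T_def)
      then have "c \<le> k" using fin by (simp add: k_def)
      then show False using parent_less [of c] c by simp
    qed
    then have "y \<in> cell k" using y kT by (auto simp: cell_def T_def)
    moreover have "k < n" using kT n by (auto simp: T_def)
    ultimately show "y \<in> (\<Union>k<n. cell k)" by blast
  qed
qed (auto simp: cell_def)

text \<open>Call the root and every vertex with coordinate above \<open>1\<close> heavy. Heaviness passes to parents,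
  and siblings are never both heavy. Hence walking from a heavy
  \<open>j\<close> towards the root passes through every smaller heavy \<open>i\<close>; the vertex visited just
  before \<open>i\<close> is the required \<open>c\<close>.\<close>

lemma high_child:
  assumes y: "y \<in> body" and "i < j" "j < n" "1 < coord y j" "i = 0 \<or> 1 < coord y i"
  obtains c where "c \<in> {1..<n}" "p c = i" "c \<le> j" "coord y j \<le> coord y c"
proof -
  have mono: "coord y c < coord y (p c)" if "c \<in> {1..<n}" for c
    using y that by (simp add: body_def)
  have sib: "c = c'" if "c \<in> {1..<n}" "c' \<in> {1..<n}" "p c = p c'" "1 < coord y c" "1 < coord y c'" for c c'
  proof (rule ccontr)
    assume "c \<noteq> c'"
    then have "coord y c + coord y c' < 1" using y that by (simp add: body_def)
    then show False using that by linarith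
  qed
  have "\<exists>c\<in>{1..<n}. p c = i \<and> c \<le> j \<and> coord y j \<le> coord y c"
    if "i < j" "j < n" "1 < coord y j" "i = 0 \<or> 1 < coord y i" for i j
    using that
  proof (induction j arbitrary: i rule: less_induct)
    case (less j)
    have j: "j \<in> {1..<n}" using less.prems by simp
    have pj: "p j < j" using parent_less j by simp
    have hi: "1 < coord y (p j)" using mono [OF j] less.prems by linarith
    consider "p j = i" | "i < p j" | "p j < i" by linarith
    then show ?case
    proof cases
      case 1
      then show ?thesis using j by auto
    next
      case 2
      obtain c where "c \<in> {1..<n}" "p c = i" "c \<le> p j" "coord y (p j) \<le> coord y c"
        using less.IH [OF pj 2 _ hi] pj less.prems by auto
      then show ?thesis using pj mono [OF j] by (intro bexI [of _ c]) auto
    next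
      case 3
      then have i: "1 < coord y i" using less.prems by auto
      obtain c where c: "c \<in> {1..<n}" "p c = p j" "c \<le> i" "coord y i \<le> coord y c"
        using less.IH [OF less.prems(1) 3 _ i] hi less.prems by auto
      then have "c = j" using sib [of c j] j i less.prems by auto
      then show ?thesis using c less.prems by simp
    qed
  qed
  then show thesis using assms that by blast
qed

text \<open>Let \<open>c\<close> be the child of \<open>i\<close> towards \<open>j\<close>. The cell of \<open>i\<close> bounds its coordinate by
  \<open>2c + 1\<close>, while it is at least the coordinate of \<open>j\<close>, which exceeds \<open>2j\<close>. So \<open>j \<le> c\<close>, and \<open>j\<close> is
  itself the child.\<close>

lemma cells_meet_imp_parent:
  assumes y: "y \<in> cell i" "y \<in> cell j" and "i < j" "j < n"
  shows "p j = i"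
proof -
  have "2 * real j < coord y j" "0 < i \<Longrightarrow> 2 * real i < coord y i"
    using assms by (auto simp: cell_def)
  moreover have "1 \<le> real j" "0 < i \<Longrightarrow> 1 \<le> real i" using assms by auto
  ultimately have hi: "1 < coord y j" "i = 0 \<or> 1 < coord y i" by fastforce+
  have "y \<in> body" using y by (simp add: cell_def)
  then obtain c where c: "c \<in> {1..<n}" "p c = i" "c \<le> j" "coord y j \<le> coord y c"
    using high_child assms hi by blast
  then have "coord y c < 2 * real c + 1" using y by (simp add: cell_def)
  then have "j \<le> c" using c \<open>2 * real j < coord y j\<close> by linarith
  then show ?thesis using c by simp
qed

text \<open>The path from \<open>k\<close> to the root; the last clause says that it contains at most one child of
  each vertex.\<close>

lemma ancestors:
  assumes "k < n"
  shows "\<exists>A. k \<in> A \<and> A \<subseteq> {..k} \<and> (\<forall>u\<in>A. 0 < u \<longrightarrow> p u \<in> A) \<and>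
    (\<forall>u\<in>A. \<forall>v\<in>A. 0 < u \<longrightarrow> 0 < v \<longrightarrow> p u = p v \<longrightarrow> u = v)"
  using assms
proof (induction k rule: less_induct)
  case (less k)
  show ?case
  proof (cases "k = 0")
    case True
    then show ?thesis by (intro exI [of _ "{0}"]) auto
  next
    case False
    then have pk: "p k < k" using parent_less less.prems by simp
    then obtain A where A: "p k \<in> A" "A \<subseteq> {..p k}" "\<forall>u\<in>A. 0 < u \<longrightarrow> p u \<in> A"
      "\<forall>u\<in>A. \<forall>v\<in>A. 0 < u \<longrightarrow> 0 < v \<longrightarrow> p u = p v \<longrightarrow> u = v"
      using less.IH [OF pk] less.prems by auto
    have "p u \<noteq> p k \<and> p k \<noteq> p u" if "u \<in> A" "0 < u" for u
      using parent_less [of u] that A(2) pk less.prems by fastforce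
    then show ?thesis using A pk by (intro exI [of _ "insert k A"]) auto
  qed
qed

text \<open>A common point is obtained by making the ancestors of \<open>k\<close> very heavy and all other vertices very
  light, while \<open>k\<close> itself is put in the middle of its window \<open>(2k, 2k+1)\<close>.\<close>

lemma cell_meets_parent:
  assumes k: "0 < k" "k < n"
  shows "cell k \<inter> cell (p k) \<noteq> {}"
proof -
  have pk: "p k < k" using parent_less k by simp
  obtain A where A: "p k \<in> A" "A \<subseteq> {..p k}" "\<forall>u\<in>A. 0 < u \<longrightarrow> p u \<in> A"
    "\<forall>u\<in>A. \<forall>v\<in>A. 0 < u \<longrightarrow> 0 < v \<longrightarrow> p u = p v \<longrightarrow> u = v"
    using ancestors [OF order.strict_trans [OF pk k(2)]] by (elim exE conjE)
  \<comment> \<open>The summand \<open>- u\<close> makes the values strictly decreasing along branches, and \<open>4n\<close> exceeds all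
    thresholds.\<close>
  define f where "f u = (if u = k then 2 * real k + 1 / 2
    else if u \<in> A then 4 * real n - real u else - 4 * real n - real u)" for u
  obtain y where y: "y \<in> coord_space n" and yf: "\<And>i. i < n \<Longrightarrow> coord y i = f i"
    using coord_space_point [of n f] by blast
  have A_less: "u < k" if "u \<in> A" for u using that A(2) pk by auto
  have kA: "k \<notin> A" using A_less by blast
  have n1: "real k + 1 \<le> real n" using k by linarith
  have high: "f u > 3 * real n" if "u \<in> A" for u
    using A_less [OF that] n1 that by (auto simp: f_def)
  have mono: "f c < f (p c)" if c: "c \<in> {1..<n}" for c
  proof -
    have pc: "real (p c) < real c" using parent_less c by simp
    consider "c = k" | "c \<noteq> k" "c \<in> A" | "c \<noteq> k" "c \<notin> A" by blast
    then show ?thesis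
    proof cases
      case 1
      then show ?thesis using high [OF A(1)] n1 by (simp add: f_def)
    next
      case 2
      then have "p c \<in> A" using A(3) c by simp
      then show ?thesis using 2 pc kA by (auto simp: f_def)
    next
      case 3
      then show ?thesis using pc c by (auto simp: f_def)
    qed
  qed
  have sib: "f c + f c' < 1" if c: "c \<in> {1..<n}" "c' \<in> {1..<n}" "c \<noteq> c'" "p c = p c'" for c c'
  proof -
    have one_high: "\<not> (c \<in> insert k A \<and> c' \<in> insert k A)"
    proof -
      have no: "p u \<noteq> p k" if "u \<in> A" "0 < u" for u
        using parent_less [of u] that A(2) pk k A_less [OF that(1)] by fastforce
      have "0 < c" "0 < c'" using c by auto
      then show ?thesis using c(3,4) A(4) no [of c] no [of c'] by (metis insertE)
    qed
    have up: "f u \<le> 4 * real n - 1" if "u \<in> {1..<n}" for u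
      using that n1 by (auto simp: f_def)
    have low: "f u = - 4 * real n - real u" if "u \<notin> insert k A" for u
      using that by (auto simp: f_def)
    from one_high consider "c \<notin> insert k A" | "c' \<notin> insert k A" by blast
    then show ?thesis
    proof cases
      case 1
      then show ?thesis using low [OF 1] up [OF c(2)] by linarith
    next
      case 2
      then show ?thesis using low [OF 2] up [OF c(1)] by linarith
    qed
  qed
  have child: "f c < 2 * real c + 1" if "c \<in> {1..<n}" "p c = k \<or> p c = p k" for c
  proof (cases "c = k")
    case True
    then show ?thesis by (simp add: f_def)
  next
    case False
    have "p k < c" using parent_less [of c] that pk by auto
    then have "c \<notin> A" using A(2) by auto
    then show ?thesis using False by (auto simp: f_def)
  qed
  have p_less: "p c < n" if "c \<in> {1..<n}" for c using parent_less [of c] that by simp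
  have "y \<in> body"
    using y yf mono sib p_less by (simp add: body_def)
  moreover have "2 * real k < f k" by (simp add: f_def)
  moreover have "2 * real (p k) < f (p k)" using high [OF A(1)] pk n1 by linarith
  ultimately have "y \<in> cell k" "y \<in> cell (p k)"
    using yf child pk k by (auto simp: cell_def)
  then show ?thesis by blast
qed

lemma cell_nonempty:
  assumes "k < n"
  shows "cell k \<noteq> {}"
proof (cases "k = 0 \<and> n = 1")
  case True
  obtain y where "y \<in> coord_space n" using coord_space_point by blast
  moreover have "{1..<n} = {}" using True by simp
  ultimately have "y \<in> cell k" using True unfolding cell_def body_def by blast
  then show ?thesis by blast
next
  case False
  then consider "0 < k" | "k = 0" "1 < n" using n by linarith
  then show ?thesis
  proof cases
    case 1
    then show ?thesis using cell_meets_parent assms by blast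
  next
    case 2
    then have "p 1 = k" using parent_less [of 1] by simp
    then show ?thesis using cell_meets_parent [of 1] 2 by auto
  qed
qed

end

text \<open>Among the vertices of a face, the largest has every other one as its parent, so there is at most
  one other.\<close>

lemma parent_tree_nerve:
  assumes "parent_tree n p" and gV: "g ` {..<n} \<subseteq> V"
    and U: "\<And>k. k < n \<Longrightarrow> U (g k) = parent_tree.cell n p k"
    and U': "\<And>i. i \<in> V \<Longrightarrow> i \<notin> g ` {..<n} \<Longrightarrow> U i = {}"
  shows "nerve V U = insert {} ((\<lambda>k. {g k}) ` {..<n} \<union> (\<lambda>k. {g k, g (p k)}) ` {1..<n})"
proof -
  interpret parent_tree n p by fact
  show ?thesis
  proof (intro equalityI subsetI)
    fix \<sigma> assume "\<sigma> \<in> nerve V U"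
    then have \<sigma>: "\<sigma> \<subseteq> V" and int: "nerve_inter V U \<sigma> \<noteq> {}" by (auto simp: nerve_def)
    show "\<sigma> \<in> insert {} ((\<lambda>k. {g k}) ` {..<n} \<union> (\<lambda>k. {g k, g (p k)}) ` {1..<n})"
    proof (cases "\<sigma> = {}")
      case False
      then obtain y where y: "\<And>i. i \<in> \<sigma> \<Longrightarrow> y \<in> U i" using int by (auto simp: nerve_inter_def)
      define I where "I = {k. k < n \<and> g k \<in> \<sigma>}"
      have \<sigma>I: "\<sigma> = g ` I" using U' y \<sigma> unfolding I_def by fastforce
      have I: "k < n" "y \<in> cell k" if "k \<in> I" for k using that y U by (auto simp: I_def)
      have par: "p j = i" if "i \<in> I" "j \<in> I" "i < j" for i j
        using cells_meet_imp_parent that I by blast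
      have fin: "finite I" by (simp add: I_def)
      have "I \<noteq> {}" using False \<sigma>I by blast
      define k where "k = Max I"
      have k: "k \<in> I" using Max_in fin \<open>I \<noteq> {}\<close> by (simp add: k_def)
      have "i = k \<or> i = p k" if "i \<in> I" for i
      proof -
        have "i \<le> k" using that fin by (simp add: k_def)
        then show ?thesis using par [OF that k] by (cases "i = k") auto
      qed
      then consider "I = {k}" | "I = {k, p k}" "p k \<noteq> k" using k by blast
      then show ?thesis
      proof cases
        case 1
        then show ?thesis using \<sigma>I I k by auto
      next
        case 2
        have "p k \<in> I" using 2 by blast
        then have "p k \<le> k" using fin by (simp add: k_def)
        then show ?thesis using 2 \<sigma>I I [OF k] by auto
      qed
    qed simp
  next
    fix \<sigma> assume "\<sigma> \<in> insert {} ((\<lambda>k. {g k}) ` {..<n} \<union> (\<lambda>k. {g k, g (p k)}) ` {1..<n})"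
    then consider "\<sigma> = {}" | k where "k < n" "\<sigma> = {g k}" | k where "1 \<le> k" "k < n" "\<sigma> = {g k, g (p k)}"
      by auto
    then show "\<sigma> \<in> nerve V U"
    proof cases
      case 1
      have "U (g 0) \<noteq> {}" "g 0 \<in> V" using U cell_nonempty n gV by auto
      then show ?thesis using 1 by (auto simp: nerve_def nerve_inter_def)
    next
      case (2 k)
      then show ?thesis using U cell_nonempty gV by (auto simp: nerve_def nerve_inter_def)
    next
      case (3 k)
      then have "p k < n" "k < n" using parent_less [of k] by auto
      then show ?thesis using 3 cell_meets_parent [of k] gV U by (auto simp: nerve_def nerve_inter_def)
    qed
  qed
qed

lemma leaf_built_representable:
  assumes "leaf_built \<Delta>" and \<Delta>V: "\<Delta> \<subseteq> Pow V"
  shows "convex_union_representable V \<Delta>"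
proof -
  obtain n and g :: "nat \<Rightarrow> 'a" and p where n: "0 < n" and inj: "inj_on g {..<n}"
    and p: "\<forall>k\<in>{1..<n}. p k < k"
    and \<Delta>: "\<Delta> = insert {} ((\<lambda>k. {g k}) ` {..<n} \<union> (\<lambda>k. {g k, g (p k)}) ` {1..<n})"
    by (rule leaf_built_enumeration [OF assms(1)])
  interpret parent_tree n p by unfold_locales (use n p in auto)
  have gV: "g ` {..<n} \<subseteq> V" using \<Delta>V unfolding \<Delta> by auto
  define U where "U i = (if i \<in> g ` {..<n} then cell (the_inv_into {..<n} g i) else {})" for i
  have Ug: "U (g k) = cell k" if "k < n" for k
    using that by (simp add: U_def the_inv_into_f_f [OF inj])
  have nerve: "nerve V U = \<Delta>"
    unfolding \<Delta> by (rule parent_tree_nerve [OF parent_tree_axioms gV Ug]) (auto simp: U_def)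
  have "(\<Union>i\<in>V. U i) = (\<Union>i\<in>g ` {..<n}. U i)" using gV by (auto simp: U_def split: if_splits)
  also have "\<dots> = body" using Ug by (simp add: body_eq_Union_cells)
  finally have "convex (\<Union>i\<in>V. U i)" using convex_body by simp
  moreover have "openin (top_of_set (coord_space n)) (U i) \<and> convex (U i)" for i
    using openin_cell convex_cell by (simp add: U_def)
  ultimately show ?thesis
    unfolding convex_union_representable_def using nerve by metis
qed

section \<open>Representability, collapsibility and trees\<close>

theorem corollary8p7:
  fixes V :: "'a set" and \<Delta> :: "'a set set"
  assumes "abstract_simplicial_complex V \<Delta>"
    and "has_dimension \<Delta> 1"
  shows "(convex_union_representable V \<Delta> \<longleftrightarrow> collapsible \<Delta>) \<and>
         (convex_union_representable V \<Delta> \<longleftrightarrow> graph_tree \<Delta>)"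
proof -
  have fin: "finite V" and \<Delta>V: "\<Delta> \<subseteq> Pow V" and down: "\<And>\<sigma> \<tau>. \<sigma> \<in> \<Delta> \<Longrightarrow> \<tau> \<subseteq> \<sigma> \<Longrightarrow> \<tau> \<in> \<Delta>"
    using assms(1) unfolding abstract_simplicial_complex_def by blast+
  have small: "card \<sigma> \<le> 2" if "\<sigma> \<in> \<Delta>" for \<sigma>
    using assms(2) that unfolding has_dimension_def face_dim_def by fastforce
  obtain \<sigma> where \<sigma>: "\<sigma> \<in> \<Delta>" "card \<sigma> = 2"
    using assms(2) unfolding has_dimension_def face_dim_def by fastforce
  then obtain v where "v \<in> \<sigma>" by fastforce
  then have "v \<in> complex_vertices \<Delta>" using down [OF \<sigma>(1)] by (simp add: complex_vertices_def)
  then have vert: "complex_vertices \<Delta> \<noteq> {}" by blast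
  have graph: "graph_like \<Delta>"
    unfolding graph_like_def using small down \<Delta>V finite_subset [OF _ fin] by auto
  have fin_vert: "finite (complex_vertices \<Delta>)"
    by (rule finite_subset [OF _ fin]) (use \<Delta>V in \<open>auto simp: complex_vertices_def\<close>)
  have "collapsible \<Delta> \<longleftrightarrow> leaf_built \<Delta>"
    using collapsible_leaf_built [OF _ graph] leaf_built_collapsible \<sigma> by blast
  moreover have "graph_tree \<Delta> \<Longrightarrow> leaf_built \<Delta>"
    using graph_tree_leaf_built [OF _ graph fin_vert] .
  moreover have "leaf_built \<Delta> \<Longrightarrow> convex_union_representable V \<Delta>"
    using leaf_built_representable [OF _ \<Delta>V] .
  moreover have "convex_union_representable V \<Delta> \<Longrightarrow> graph_tree \<Delta>"
    using convex_union_representable_graph_tree small vert by metis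
  ultimately show ?thesis by blast
qed

end
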